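(* Let $\mathcal{P}$ and $\mathcal{Q}$ be two graph classes. Then $\mathcal{P} \subseteq \mathcal{Q}$ if and only if $c_{\mathcal{P}}(G) \geq c_{\mathcal{Q}}(G)$ for all graphs $G$.
   Context: Graphs are finite, simple and have a nonempty vertex set. For a class of graphs $\mathcal{P}$, a covering of a graph $G$ by graphs of class $\mathcal{P}$ is an expression $E(G) = E(G_1) \cup \dots \cup E(G_k)$ with $k \geq 1$, where each $G_i$ is a graph on the vertex set $V(G)$ and $G_i \in \mathcal{P}$. The cover number $c_{\mathcal{P}}(G)$ is the smallest such $k$, with $c_{\mathcal{P}}(G) = \infty$ if no covering exists. *)

theory Defs
  imports "Graph_Theory.Pair_Digraph" "HOL-Library.Extended_Nat"
begin

(* As in Graph_Theory, an undirected edge uv is the pair of arcs (u,v), (v,u), so the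
   edge set is the symmetric irreflexive relation parcs G; pair_graph G says that G is
   finite, loopless and symmetric, but admits the graph without vertices. *)
definition simple_graph :: "'a pair_pre_digraph \<Rightarrow> bool" where
  "simple_graph G \<longleftrightarrow> pair_graph G \<and> pverts G \<noteq> {}"

(* Closure under isomorphism is not required. *)
definition graph_class :: "'a pair_pre_digraph set \<Rightarrow> bool" where
  "graph_class P \<longleftrightarrow> (\<forall>G\<in>P. simple_graph G)"

definition covering ::
  "'a pair_pre_digraph set \<Rightarrow> 'a pair_pre_digraph \<Rightarrow> nat \<Rightarrow> (nat \<Rightarrow> 'a pair_pre_digraph) \<Rightarrow> bool" where
  "covering P G k H \<longleftrightarrow>
     k \<ge> 1 \<and>
     (\<forall>i\<in>{1..k}. simple_graph (H i) \<and> pverts (H i) = pverts G \<and> H i \<in> P) \<and>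
     parcs G = (\<Union>i\<in>{1..k}. parcs (H i))"

definition cover_number :: "'a pair_pre_digraph set \<Rightarrow> 'a pair_pre_digraph \<Rightarrow> enat" where
  "cover_number P G =
     (if \<exists>k H. covering P G k H then enat (LEAST k. \<exists>H. covering P G k H) else \<infinity>)"

end

theory Submission
  imports Defs
begin

text \<open>
  A graph belongs to a class exactly when its cover number is at most one: a covering by a
  single graph on the same vertex set is the graph itself. Hence the cover number determines
  the class, and comparing cover numbers at the members of \<open>P\<close> yields \<open>P \<subseteq> Q\<close>. The other
  direction is monotonicity: every covering by members of \<open>P\<close> is a covering by members
  of the larger class, so the minimum can only decrease.
\<close>

lemma cover_number_le:
  assumes "covering P G k H"
  shows "cover_number P G \<le> enat k"
  using assms unfolding cover_number_def by (auto intro: Least_le)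

lemma cover_number_attained:
  assumes "cover_number P G = enat k"
  obtains H where "covering P G k H"
proof -
  have ex: "\<exists>k H. covering P G k H"
    using assms unfolding cover_number_def by (auto split: if_splits)
  then have "k = (LEAST k. \<exists>H. covering P G k H)"
    using assms unfolding cover_number_def by simp
  then have "\<exists>H. covering P G k H"
    using LeastI_ex[OF ex] by simp
  then show thesis using that by blast
qed

lemma covering_mono:
  assumes "P \<subseteq> Q" and "covering P G k H"
  shows "covering Q G k H"
  using assms unfolding covering_def by blast

lemma cover_number_antimono:
  assumes "P \<subseteq> Q"
  shows "cover_number Q G \<le> cover_number P G"
proof (cases "cover_number P G")
  case (enat k)
  then obtain H where "covering P G k H" by (rule cover_number_attained)
  then have "cover_number Q G \<le> enat k"
    using assms by (blast intro: cover_number_le covering_mono)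
  then show ?thesis using enat by simp
qed simp

text \<open>Since the graphs of a covering all live on the vertex set of the covered graph, a single
  one of them agrees with it in vertices and in arcs.\<close>

lemma cover_number_le_1_iff:
  fixes G :: "'a pair_pre_digraph"
  assumes "simple_graph G"
  shows "cover_number P G \<le> 1 \<longleftrightarrow> G \<in> P"
proof
  assume "G \<in> P"
  then have "covering P G 1 (\<lambda>_. G)"
    using assms unfolding covering_def by simp
  then show "cover_number P G \<le> 1"
    using cover_number_le by (fastforce simp: one_enat_def)
next
  assume le: "cover_number P G \<le> 1"
  then obtain k where k: "cover_number P G = enat k" "k \<le> 1"
    by (cases "cover_number P G") (auto simp: one_enat_def)
  then obtain H where H: "covering P G k H"
    using cover_number_attained by blast
  then have "k = 1" using k unfolding covering_def by simp
  then have "H 1 \<in> P" "pverts (H 1) = pverts G" "parcs (H 1) = parcs G"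
    using H unfolding covering_def by auto
  moreover from this have "H 1 = G" by simp
  ultimately show "G \<in> P" by metis
qed

theorem theorem1:
  fixes P Q :: "'a pair_pre_digraph set"
  assumes "graph_class P" and "graph_class Q"
  shows "P \<subseteq> Q \<longleftrightarrow> (\<forall>G. simple_graph G \<longrightarrow> cover_number P G \<ge> cover_number Q G)"
proof
  assume "P \<subseteq> Q"
  then show "\<forall>G. simple_graph G \<longrightarrow> cover_number P G \<ge> cover_number Q G"
    by (simp add: cover_number_antimono)
next
  assume le: "\<forall>G. simple_graph G \<longrightarrow> cover_number P G \<ge> cover_number Q G"
  show "P \<subseteq> Q"
  proof
    fix G assume "G \<in> P"
    then have G: "simple_graph G" using assms(1) unfolding graph_class_def by blast
    then have "cover_number P G \<le> 1"
      using \<open>G \<in> P\<close> cover_number_le_1_iff by blast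
    then have "cover_number Q G \<le> 1"
      using le G order_trans by blast
    then show "G \<in> Q" using G cover_number_le_1_iff by blast
  qed
qed

end
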